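(* Every locally compact and connected Hausdorff topological lattice is a completely regular ordered space.
   Context: A Hausdorff topological lattice is a lattice $(X,\preceq)$ where $X$ carries a Hausdorff topology such that $(x,y)\mapsto x\wedge y$ and $(x,y)\mapsto x\vee y$ are continuous from $X\times X$ into $X$; it is locally compact (connected) if the space $X$ is. A topological poset is a poset $(X,\preceq)$ with $X$ a nonempty topological space such that $\preceq$ is a closed subset of $X\times X$. A topological poset $(X,\preceq)$ is a completely regular ordered space if (1) for every $x,y\in X$ such that $x\preceq y$ is false, there exists a continuous and order-preserving $f:X\to\mathbb{R}$ with $f(x)>f(y)$; and (2) for every $x\in X$ and every neighborhood $V$ of $x$ in $X$, there are continuous functions $f:X\to[0,1]$ and $g:X\to[0,1]$ such that $f$ is order-preserving ($x\preceq y\Rightarrow f(x)\le f(y)$), $g$ is order-reversing ($x\preceq y\Rightarrow g(y)\le g(x)$), $f(x)=1=g(x)$, and $\min\{f(z),g(z)\}=0$ for all $z\in X\setminus V$. *)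

theory Defs
  imports "HOL-Analysis.Analysis"
begin

text \<open>
  The underlying space of each structure is a whole type, with the topology and the order given
  by type classes; it is nonempty because types are. Products such as \<^typ>\<open>'a \<times> 'a\<close> carry the
  product topology.
\<close>

definition topological_lattice :: "'a::{topological_space, lattice} itself \<Rightarrow> bool" where
  "topological_lattice _ \<longleftrightarrow>
     continuous_on UNIV (\<lambda>(x :: 'a, y). inf x y) \<and>
     continuous_on UNIV (\<lambda>(x :: 'a, y). sup x y)"

definition topological_poset :: "'a::{topological_space, order} itself \<Rightarrow> bool" where
  "topological_poset _ \<longleftrightarrow> closed {(x :: 'a, y). x \<le> y}"

text \<open>A neighborhood of \<open>x\<close> is any set, not necessarily open, with \<open>x\<close> in its interior.\<close>

definition completely_regular_ordered_space :: "'a::{topological_space, order} itself \<Rightarrow> bool" where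
  "completely_regular_ordered_space T \<longleftrightarrow>
     topological_poset T \<and>
     (\<forall>x y :: 'a. \<not> x \<le> y \<longrightarrow>
        (\<exists>f :: 'a \<Rightarrow> real. continuous_on UNIV f \<and> mono f \<and> f x > f y)) \<and>
     (\<forall>(x :: 'a) V. x \<in> interior V \<longrightarrow>
        (\<exists>f g :: 'a \<Rightarrow> real.
           continuous_on UNIV f \<and> range f \<subseteq> {0..1} \<and> mono f \<and>
           continuous_on UNIV g \<and> range g \<subseteq> {0..1} \<and> antimono g \<and>
           f x = 1 \<and> g x = 1 \<and> (\<forall>z \<in> - V. min (f z) (g z) = 0)))"

end

theory Submission
  imports Defs
begin

text \<open>
  The order is closed because \<open>x \<le> y\<close> means \<open>inf x y = x\<close>. Connectedness enters through the
  intervals: \<open>z \<mapsto> inf (sup z a) b\<close> retracts the space onto \<open>{a..b}\<close>, so intervals are connected,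
  and an interval that contains points inside and outside an open set \<open>U\<close> meets the frontier
  of \<open>U\<close>. Local compactness supplies, at every point, small \<open>U\<close> with compact frontier. (Intervals
  themselves need not be compact: consider the unit square without its corner \<open>(0, 1)\<close>.)

  Separating two points. If \<open>\<not> x \<le> y\<close>, then \<open>y < sup x y\<close>. Since \<open>{y..sup x y}\<close> is connected, it
  has points \<open>b > y\<close> as near to \<open>y\<close> as desired, and for \<open>b\<close> near enough \<open>{y..b}\<close> misses the
  frontier of \<open>U\<close> and is therefore compact (\<open>compact_interval_above\<close>). Nachbin's order-theoretic
  Urysohn lemma (\<open>compact_ordered_space_separation\<close>) gives a monotone continuous function on
  \<open>{y..b}\<close> separating \<open>y\<close> from \<open>b\<close>. Composing it with the monotone retraction onto \<open>{y..b}\<close>, which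
  fixes \<open>y\<close> and sends \<open>x\<close> to \<open>b\<close>, gives the global function (\<open>monotone_separation\<close>).

  Separating a point from the complement of a neighbourhood. Let \<open>U\<close> be an open set around \<open>x\<close>
  with compact frontier. Any point of the frontier is either not above or not below \<open>x\<close>,
  so finitely many separating functions combine to an increasing \<open>f\<close> and a decreasing \<open>g\<close> that
  equal 1 at \<open>x\<close> and whose minimum vanishes on the frontier. Nothing is known about \<open>f\<close> and \<open>g\<close>
  beyond the frontier, so they are replaced by \<open>z \<mapsto> f (inf z x)\<close> and \<open>z \<mapsto> g (sup z x)\<close>. If both of
  these are positive at \<open>z\<close>, then the original \<open>min f g\<close> is positive on the connected intervals from \<open>inf z x\<close> to \<open>x\<close> and
  to \<open>z\<close>; neither crosses the frontier, so starting from \<open>x\<close> in \<open>U\<close> one stays in \<open>U\<close>, first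
  to \<open>inf z x\<close> and then to \<open>z\<close> (\<open>bump_pair_vanishing_off_neighbourhood\<close>).
\<close>

section \<open>Monotone Urysohn functions on compact ordered spaces\<close>

text \<open>
  The tube lemma: a point above no element of \<open>F\<close> stays so under small perturbation, uniformly
  over the compact set \<open>F\<close>, because the order is closed.
\<close>

lemma closed_upset_of_compact:
  fixes F :: "'a::{topological_space, order} set"
  assumes "topological_poset TYPE('a)" "compact F"
  shows "closed {z. \<exists>w\<in>F. w \<le> z}"
proof -
  have W: "open (- {(x :: 'a, y). x \<le> y})"
    using assms(1) by (simp add: topological_poset_def open_Compl)
  have "open (- {z. \<exists>w\<in>F. w \<le> z})"
  proof (subst open_subopen, intro ballI)
    fix z assume z: "z \<in> - {z. \<exists>w\<in>F. w \<le> z}"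
    have "open (prod.swap -` (- {(x :: 'a, y). x \<le> y}))"
      by (intro open_vimage W continuous_intros continuous_on_swap)
    moreover have "{z} \<times> F \<subseteq> prod.swap -` (- {(x :: 'a, y). x \<le> y})"
      using z by auto
    ultimately have "\<exists>X0. z \<in> X0 \<and> open X0 \<and> X0 \<times> F \<subseteq> prod.swap -` (- {(x :: 'a, y). x \<le> y})"
      by (rule Elementary_Topology.tube_lemma[OF assms(2)])
    then obtain X0 where "z \<in> X0" "open X0"
        "X0 \<times> F \<subseteq> prod.swap -` (- {(x :: 'a, y). x \<le> y})"
      by blast
    then show "\<exists>T. open T \<and> z \<in> T \<and> T \<subseteq> - {z. \<exists>w\<in>F. w \<le> z}"
      by (intro exI[of _ X0]) auto
  qed
  then show ?thesis by (simp add: closed_def)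
qed

lemma closed_downset_of_compact:
  fixes F :: "'a::{topological_space, order} set"
  assumes "topological_poset TYPE('a)" "compact F"
  shows "closed {z. \<exists>w\<in>F. z \<le> w}"
proof -
  have W: "open (- {(x :: 'a, y). x \<le> y})"
    using assms(1) by (simp add: topological_poset_def open_Compl)
  have "open (- {z. \<exists>w\<in>F. z \<le> w})"
  proof (subst open_subopen, intro ballI)
    fix z assume z: "z \<in> - {z. \<exists>w\<in>F. z \<le> w}"
    have "{z} \<times> F \<subseteq> - {(x :: 'a, y). x \<le> y}"
      using z by auto
    then obtain X0 where "z \<in> X0" "open X0" "X0 \<times> F \<subseteq> - {(x :: 'a, y). x \<le> y}"
      using Elementary_Topology.tube_lemma[OF assms(2) W] by meson
    then show "\<exists>T. open T \<and> z \<in> T \<and> T \<subseteq> - {z. \<exists>w\<in>F. z \<le> w}"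
      by (intro exI[of _ X0]) auto
  qed
  then show ?thesis by (simp add: closed_def)
qed

lemma closed_upper_lower:
  fixes a :: "'a::{topological_space, order}"
  assumes "topological_poset TYPE('a)"
  shows "closed {a..}" "closed {..a}"
  using closed_upset_of_compact[OF assms, of "{a}"] closed_downset_of_compact[OF assms, of "{a}"]
  by (simp_all add: atLeast_def atMost_def)

definition compact_downset :: "'a::{topological_space, order} set \<Rightarrow> 'a set \<Rightarrow> bool" where
  "compact_downset K P \<longleftrightarrow>
     compact P \<and> P \<subseteq> K \<and> (\<forall>w\<in>P. \<forall>z\<in>K. z \<le> w \<longrightarrow> z \<in> P)"

text \<open>
  \<open>Q\<close> is a neighbourhood of \<open>P\<close> in the subspace \<open>K\<close>. This is the relation along which the sublevel sets of a monotone continuous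
  function on \<open>K\<close> are nested.
\<close>

definition well_inside :: "'a::{topological_space, order} set \<Rightarrow> 'a set \<Rightarrow> 'a set \<Rightarrow> bool" where
  "well_inside K P Q \<longleftrightarrow>
     compact_downset K P \<and> compact_downset K Q \<and> (\<exists>U. open U \<and> P \<subseteq> U \<and> U \<inter> K \<subseteq> Q)"

lemma well_inside_subset:
  assumes "well_inside K P Q"
  shows "P \<subseteq> Q"
proof -
  obtain U where "P \<subseteq> U" "U \<inter> K \<subseteq> Q" using assms by (auto simp: well_inside_def)
  moreover have "P \<subseteq> K" using assms by (simp add: well_inside_def compact_downset_def)
  ultimately show ?thesis by (meson IntI subset_iff)
qed

lemma Hausdorff_space_euclidean_t2: "Hausdorff_space (euclidean :: 'a::t2_space topology)"
  unfolding Hausdorff_space_def disjnt_def by simp (metis hausdorff)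

text \<open>
  The order-theoretic form of normality. The points of \<open>K\<close> above some point of \<open>K - U\<close> form a
  compact set \<open>E\<close>, disjoint from the downset \<open>P\<close>. Separate \<open>P\<close> and \<open>E\<close> by open sets
  \<open>U1\<close> and \<open>V1\<close>, and take for \<open>M\<close> the downset generated by \<open>K - V1\<close>: it contains \<open>U1 \<inter> K\<close>, and
  it misses \<open>K - U\<close> since \<open>E\<close> is an upset contained in \<open>V1\<close>.
\<close>

lemma compact_downset_interpolation:
  fixes K :: "'a::{t2_space, order} set"
  assumes po: "topological_poset TYPE('a)" and K: "compact K"
    and P: "compact_downset K P" and U: "open U" "P \<subseteq> U"
  obtains M where "well_inside K P M" "M \<subseteq> U"
proof -
  define E where "E = {z. \<exists>w\<in>K - U. w \<le> z} \<inter> K"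
  have "compact (K - U)" using K U by (simp add: compact_diff)
  then have "compact E"
    unfolding E_def using K closed_upset_of_compact[OF po]
    by (simp add: closed_Int_compact)
  moreover have "compact P" using P by (simp add: compact_downset_def)
  moreover have "disjnt P E"
    using P U(2) unfolding compact_downset_def disjnt_iff E_def by blast
  ultimately obtain U1 V1 where UV: "open U1" "open V1" "P \<subseteq> U1" "E \<subseteq> V1" "disjnt U1 V1"
    using Hausdorff_space_compact_separation[OF Hausdorff_space_euclidean_t2, of P E]
    by (metis compactin_euclidean_iff open_openin)
  define M where "M = {z. \<exists>w\<in>K - V1. z \<le> w} \<inter> K"
  have "compact (K - V1)" using K UV by (simp add: compact_diff)
  then have "compact M"
    unfolding M_def using K closed_downset_of_compact[OF po] by (simp add: closed_Int_compact)
  then have "compact_downset K M"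
    unfolding compact_downset_def M_def using order_trans by blast
  moreover have "U1 \<inter> K \<subseteq> M" using UV(5) unfolding M_def disjnt_iff by blast
  ultimately have "well_inside K P M"
    unfolding well_inside_def using P UV by blast
  moreover have "M \<subseteq> U"
  proof
    fix z assume "z \<in> M"
    then obtain w where w: "w \<in> K" "w \<notin> V1" "z \<le> w" "z \<in> K" unfolding M_def by blast
    show "z \<in> U"
    proof (rule ccontr)
      assume "z \<notin> U"
      with w have "w \<in> E" unfolding E_def by blast
      with UV w show False by blast
    qed
  qed
  ultimately show thesis by (rule that)
qed

lemma dyadic_between:
  fixes a b :: real
  assumes "0 \<le> a" "a < b"
  obtains r where "r \<in> dyadics" "a < r" "r < b"
proof -
  have "closure ({a<..<b} \<inter> dyadics) = closure {a<..<b}"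
    unfolding dyadics_def
    by (rule closure_dyadic_rationals_in_convex_set_pos_1) (use assms in \<open>auto simp: interior_open\<close>)
  then have "{a<..<b} \<inter> dyadics \<noteq> {}" using assms by auto
  then show thesis using that by auto
qed

text \<open>
  Urysohn's construction for compact downsets: interpolate a family \<open>F r\<close>, indexed by the dyadic
  rationals of the unit interval, between \<open>{..p}\<close> and a neighbourhood of it that omits \<open>q\<close>, and
  map \<open>z\<close> to the infimum of the \<open>r\<close> with \<open>z \<in> F r\<close>. The function is monotone because each \<open>F r\<close>
  is a downset, lower semicontinuous because each is closed, and upper semicontinuous because
  each is a neighbourhood of the preceding ones.
\<close>

theorem compact_ordered_space_separation:
  fixes K :: "'a::{t2_space, order} set"
  assumes po: "topological_poset TYPE('a)" and K: "compact K"
    and pq: "p \<in> K" "q \<in> K" "\<not> q \<le> p"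
  obtains f :: "'a \<Rightarrow> real"
  where "continuous_on K f" "mono_on K f" "f p < f q"
proof -
  define P where "P = {..p} \<inter> K"
  have P: "compact_downset K P"
    unfolding compact_downset_def P_def
    using closed_Int_compact[OF closed_upper_lower(2)[OF po] K] by auto
  have "open (- {q..})" "P \<subseteq> - {q..}"
    using closed_upper_lower(1)[OF po] pq by (auto simp: P_def intro: order_trans)
  then obtain M where M: "well_inside K P M" "M \<subseteq> - {q..}"
    by (rule compact_downset_interpolation[OF po K P])
  have "\<exists>F :: real \<Rightarrow> 'a set. F 0 = P \<and> F 1 = M \<and>
      (\<forall>x \<in> dyadics \<inter> {0..1}. \<forall>y \<in> dyadics \<inter> {0..1}. x < y \<longrightarrow> well_inside K (F x) (F y))"
  proof (rule recursion_on_dyadic_fractions)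
    show "well_inside K P M" by fact
    show "\<exists>z. well_inside K x z \<and> well_inside K z y" if xy: "well_inside K x y" for x y
    proof -
      obtain U where U: "open U" "x \<subseteq> U" "U \<inter> K \<subseteq> y" and x: "compact_downset K x"
        using xy unfolding well_inside_def by blast
      obtain z where "well_inside K x z" "z \<subseteq> U"
        using compact_downset_interpolation[OF po K x U(1,2)] .
      then show ?thesis using xy U unfolding well_inside_def by blast
    qed
    show "well_inside K x z" if xy: "well_inside K x y" and yz: "well_inside K y z" for x y z
    proof -
      obtain U where U: "open U" "x \<subseteq> U" "U \<inter> K \<subseteq> y"
        using xy unfolding well_inside_def by blast
      then have "U \<inter> K \<subseteq> z" using well_inside_subset[OF yz] by order
      then show ?thesis using U xy yz unfolding well_inside_def by blast
    qed
  qed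
  then obtain F :: "real \<Rightarrow> 'a set" where F0: "F 0 = P" and F1: "F 1 = M"
    and F01: "\<forall>x \<in> dyadics \<inter> {0..1}. \<forall>y \<in> dyadics \<inter> {0..1}.
                x < y \<longrightarrow> well_inside K (F x) (F y)"
    by (elim exE conjE)
  have F: "well_inside K (F x) (F y)"
    if "x \<in> dyadics" "y \<in> dyadics" "0 \<le> x" "x < y" "y \<le> 1" for x y
    using F01 that by simp
  have dy01: "0 \<in> (dyadics :: real set)" "1 \<in> (dyadics :: real set)"
    using real_in_dyadics[of 0] real_in_dyadics[of 1] by simp_all
  have Fd: "compact_downset K (F r)" if "r \<in> dyadics" "0 \<le> r" "r \<le> 1" for r
    using F[of 0 r] F[of r 1] that dy01 P F0 unfolding well_inside_def
    by (cases "r = 0") auto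
  have Fmono: "F r \<subseteq> F s" if "r \<in> dyadics" "s \<in> dyadics" "0 \<le> r" "r \<le> s" "s \<le> 1" for r s
    using F[of r s] that unfolding well_inside_def compact_downset_def
    by (cases "r = s") auto
  \<comment> \<open>Inserting 1 gives the value 1 to the points outside every \<open>F r\<close>, where the infimum would be over the empty set.\<close>
  define S where "S z = insert 1 {r \<in> dyadics \<inter> {0..1}. z \<in> F r}" for z
  define f where "f z = Inf (S z)" for z
  have bdd: "bdd_below (S z)" for z
    unfolding S_def by (rule bdd_belowI[of _ 0]) auto
  have f_le: "f z \<le> r" if "r \<in> dyadics" "0 \<le> r" "r \<le> 1" "z \<in> F r" for z r
    unfolding f_def by (rule cInf_lower[OF _ bdd]) (use that in \<open>auto simp: S_def\<close>)
  have f1: "f z \<le> 1" for z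
    unfolding f_def by (rule cInf_lower[OF _ bdd]) (auto simp: S_def)
  have f0: "0 \<le> f z" for z
    unfolding f_def by (rule cInf_greatest) (auto simp: S_def)
  have f_less: "\<exists>r. r \<in> dyadics \<and> 0 \<le> r \<and> r < a \<and> z \<in> F r" if "f z < a" "a \<le> 1" for z a
    using that cInf_less_iff[OF _ bdd, of z a] unfolding f_def S_def by auto
  have "mono_on K f"
  proof (rule mono_onI, rule ccontr)
    fix z w assume zw: "z \<in> K" "w \<in> K" "z \<le> w" "\<not> f z \<le> f w"
    then obtain r where r: "r \<in> dyadics" "0 \<le> r" "r < f z" "w \<in> F r"
      using f_less[of w "f z"] f1[of z] by auto
    moreover have "r \<le> 1" using r f1[of z] by simp
    ultimately have "z \<in> F r" using Fd[of r] zw unfolding compact_downset_def by blast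
    then show False using f_le[of r z] r \<open>r \<le> 1\<close> by simp
  qed
  moreover have "continuous_on K f"
    unfolding continuous_on_def
  proof (intro ballI order_tendstoI)
    fix z a assume z: "z \<in> K" and a: "a < f z"
    show "\<forall>\<^sub>F w in at z within K. a < f w"
    proof (cases "0 \<le> a")
      case False
      then have "a < f w" for w using f0[of w] by linarith
      then show ?thesis by simp
    next
      case True
      then obtain s where s: "s \<in> dyadics" "a < s" "s < f z" using dyadic_between a by blast
      have s1: "0 \<le> s" "s \<le> 1" using True s f1[of z] by auto
      have "z \<notin> F s" using f_le[of s z] s s1 by auto
      moreover have "open (- F s)"
        using Fd[OF s(1) s1] compact_imp_closed unfolding compact_downset_def by auto
      moreover have "a < f w" if "w \<notin> F s" for w
      proof (rule ccontr)
        assume "\<not> a < f w"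
        then obtain r where "r \<in> dyadics" "0 \<le> r" "r < s" "w \<in> F r"
          using f_less[of w s] s s1 by auto
        then show False using Fmono[of r s] s s1 that by auto
      qed
      ultimately show ?thesis
        unfolding eventually_at_topological by (intro exI[of _ "- F s"]) auto
    qed
  next
    fix z a assume z: "z \<in> K" and a: "f z < a"
    show "\<forall>\<^sub>F w in at z within K. f w < a"
    proof (cases "a \<le> 1")
      case False
      then have "f w < a" for w using f1[of w] by linarith
      then show ?thesis by simp
    next
      case True
      then obtain r where r: "r \<in> dyadics" "0 \<le> r" "r < a" "z \<in> F r" using f_less a by blast
      obtain s where s: "s \<in> dyadics" "r < s" "s < a" using dyadic_between r by blast
      obtain U where U: "open U" "F r \<subseteq> U" "U \<inter> K \<subseteq> F s"
        using F[of r s] r s True unfolding well_inside_def by auto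
      have "f w < a" if "w \<in> U" "w \<in> K" for w
        using f_le[of s w] that U s r True by auto
      then show ?thesis
        unfolding eventually_at_topological using U r by (intro exI[of _ U]) auto
    qed
  qed
  moreover have "f p < f q"
  proof -
    have "f p \<le> 0" using f_le[of 0 p] dy01 F0 pq by (auto simp: P_def)
    moreover have "1 \<le> f q"
    proof (rule ccontr)
      assume "\<not> 1 \<le> f q"
      then obtain r where "r \<in> dyadics" "0 \<le> r" "r < 1" "q \<in> F r" using f_less[of q 1] by auto
      then have "q \<in> M" using Fmono[of r 1] dy01 F1 by auto
      then show False using M by auto
    qed
    ultimately show ?thesis by simp
  qed
  ultimately show thesis using that by blast
qed

section \<open>Order and topology in topological lattices\<close>

lemma continuous_on_inf_sup:
  fixes f g :: "'b::topological_space \<Rightarrow> 'a::{topological_space, lattice}"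
  assumes "topological_lattice TYPE('a)" "continuous_on A f" "continuous_on A g"
  shows "continuous_on A (\<lambda>z. inf (f z) (g z))" "continuous_on A (\<lambda>z. sup (f z) (g z))"
proof -
  have i: "continuous_on UNIV (\<lambda>(x :: 'a, y). inf x y)"
    and s: "continuous_on UNIV (\<lambda>(x :: 'a, y). sup x y)"
    using assms(1) by (simp_all add: topological_lattice_def)
  have c: "continuous_on A (\<lambda>z. (f z, g z))" using assms by (intro continuous_intros)
  show "continuous_on A (\<lambda>z. inf (f z) (g z))" "continuous_on A (\<lambda>z. sup (f z) (g z))"
    using continuous_on_compose2[OF i c] continuous_on_compose2[OF s c] by simp_all
qed

lemma topological_lattice_imp_poset:
  assumes "topological_lattice TYPE('a::{t2_space, lattice})"
  shows "topological_poset TYPE('a)"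
proof -
  have "closed {p :: 'a \<times> 'a. inf (fst p) (snd p) = fst p}"
    by (intro closed_Collect_eq continuous_on_inf_sup[OF assms] continuous_intros)
  moreover have "{(x :: 'a, y). x \<le> y} = {p. inf (fst p) (snd p) = fst p}"
    by (auto simp: le_iff_inf)
  ultimately show ?thesis by (simp add: topological_poset_def)
qed

text \<open>
  An interval is a retract of the whole lattice, hence a continuous image of a connected space.
\<close>

lemma connected_interval:
  fixes a b :: "'a::{topological_space, lattice}"
  assumes "topological_lattice TYPE('a)" "connected (UNIV :: 'a set)" "a \<le> b"
  shows "connected {a..b}"
proof -
  have "{a..b} = (\<lambda>z. inf (sup z a) b) ` UNIV"
  proof (intro equalityI subsetI)
    fix z assume "z \<in> {a..b}"
    then have "z = inf (sup z a) b" by (simp add: sup_absorb1 inf_absorb1)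
    then show "z \<in> (\<lambda>z. inf (sup z a) b) ` UNIV" by blast
  qed (use assms in \<open>auto intro: le_infI1 le_infI2\<close>)
  moreover have "connected ((\<lambda>z. inf (sup z a) b) ` UNIV)"
    by (intro connected_continuous_image continuous_on_inf_sup[OF assms(1)] continuous_intros assms)
  ultimately show ?thesis by simp
qed

lemma small_open_with_compact_frontier:
  fixes x :: "'a::t2_space"
  assumes "locally_compact_space (euclidean :: 'a topology)" "open V" "x \<in> V"
  obtains U C where "open U" "x \<in> U" "U \<subseteq> V" "compact C" "U \<subseteq> C" "compact (frontier U)"
proof -
  obtain U0 C where U0: "open U0" "compact C" "x \<in> U0" "U0 \<subseteq> C"
    using assms(1) unfolding locally_compact_space_def by (auto dest: spec[of _ x])
  have "closure (U0 \<inter> V) \<subseteq> C"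
    using U0 compact_imp_closed by (meson Int_lower1 closure_minimal order_trans)
  then have "frontier (U0 \<inter> V) = frontier (U0 \<inter> V) \<inter> C" by (auto simp: frontier_def)
  then have "compact (frontier (U0 \<inter> V))"
    by (metis U0(2) closed_Int_compact frontier_closed)
  then show thesis using that[of "U0 \<inter> V" C] U0 assms by auto
qed

text \<open>
  The points \<open>z\<close> for which \<open>{y..z}\<close> meets the compact frontier of \<open>U\<close> form a closed set \<open>T\<close>, and by
  antisymmetry \<open>y\<close> is not among them. As \<open>{y..x}\<close> is connected and has more than one point, \<open>y\<close> is
  not isolated in it, so some \<open>b \<noteq> y\<close> in \<open>{y..x}\<close> lies outside \<open>T\<close>. The connected set \<open>{y..b}\<close> then
  stays in \<open>U\<close>, so it is a closed subset of a compact set.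
\<close>

lemma compact_interval_above:
  fixes x y :: "'a::{t2_space, lattice}"
  assumes L: "topological_lattice TYPE('a)"
    and lc: "locally_compact_space (euclidean :: 'a topology)"
    and con: "connected (UNIV :: 'a set)"
    and "y < x"
  obtains b where "y < b" "b \<le> x" "compact {y..b}"
proof -
  note po = topological_lattice_imp_poset[OF L]
  obtain U C where U: "open U" "y \<in> U" "compact C" "U \<subseteq> C" "compact (frontier U)"
    by (metis small_open_with_compact_frontier[OF lc open_UNIV UNIV_I])
  define T where "T = {z. \<exists>w\<in>{y..} \<inter> frontier U. w \<le> z}"
  have "compact ({y..} \<inter> frontier U)"
    using U closed_upper_lower[OF po] by (simp add: closed_Int_compact)
  then have T: "closed T" unfolding T_def by (rule closed_upset_of_compact[OF po])
  have "y \<notin> T" using U by (auto simp: T_def frontier_def interior_open dest: order_antisym)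
  have "\<exists>b \<in> {y..x}. b \<noteq> y \<and> b \<notin> T"
  proof (rule ccontr)
    assume *: "\<not> ?thesis"
    \<comment> \<open>Otherwise \<open>- T\<close> and \<open>- {y}\<close> would split \<open>{y..x}\<close> into \<open>{y}\<close> and the rest.\<close>
    have "- T \<inter> {y..x} = {} \<or> - {y} \<inter> {y..x} = {}"
      by (rule connectedD[OF connected_interval[OF L con less_imp_le[OF \<open>y < x\<close>]]])
        (use * T \<open>y \<notin> T\<close> in auto)
    moreover have "y \<in> - T \<inter> {y..x}" "x \<in> - {y} \<inter> {y..x}"
      using \<open>y < x\<close> \<open>y \<notin> T\<close> by auto
    ultimately show False by blast
  qed
  then obtain b where b: "y \<le> b" "b \<le> x" "b \<noteq> y" "b \<notin> T" by auto
  have "{y..b} \<inter> frontier U = {}" using b by (auto simp: T_def)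
  then have "{y..b} \<subseteq> U"
    using connected_Int_frontier[OF connected_interval[OF L con b(1)], of U] U(2) b(1)
    by (metis Diff_eq_empty_iff IntI atLeastAtMost_iff empty_iff order_refl)
  then have "{y..b} = {y..} \<inter> ({..b} \<inter> C)" using U by auto
  then have "compact {y..b}"
    using U closed_upper_lower[OF po] by (simp add: closed_Int_compact)
  moreover have "y < b" using b by simp
  ultimately show thesis using b(2) that by blast
qed

text \<open>
  The retraction onto the compact interval \<open>{y..b}\<close> is monotone, fixes \<open>y\<close>, and sends \<open>x\<close> to \<open>b\<close>
  because \<open>b \<le> sup x y\<close>; so it transports a separation of \<open>y\<close> from \<open>b\<close> to one of \<open>y\<close> from \<open>x\<close>.
\<close>

lemma monotone_separation:
  fixes x y :: "'a::{t2_space, lattice}"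
  assumes L: "topological_lattice TYPE('a)"
    and lc: "locally_compact_space (euclidean :: 'a topology)"
    and con: "connected (UNIV :: 'a set)"
    and nle: "\<not> x \<le> y"
  obtains f :: "'a \<Rightarrow> real" where "continuous_on UNIV f" "mono f" "f y < f x"
proof -
  note po = topological_lattice_imp_poset[OF L]
  have "y < sup x y" using nle by (metis less_le sup.commute sup_ge2 sup_ge1)
  then obtain b where b: "y < b" "b \<le> sup x y" "compact {y..b}"
    using compact_interval_above[OF L lc con] by metis
  obtain f :: "'a \<Rightarrow> real" where f: "continuous_on {y..b} f" "mono_on {y..b} f" "f y < f b"
    by (rule compact_ordered_space_separation[OF po b(3), of y b]) (use b in auto)
  define r where "r z = inf (sup z y) b" for z
  have rI: "r z \<in> {y..b}" for z using b unfolding r_def by auto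
  have "continuous_on UNIV r"
    unfolding r_def by (intro continuous_on_inf_sup[OF L] continuous_intros)
  then have "continuous_on UNIV (\<lambda>z. f (r z))"
    by (rule continuous_on_compose2[OF f(1)]) (use rI in auto)
  moreover have "mono (\<lambda>z. f (r z))"
  proof (rule monoI)
    fix z w :: 'a assume "z \<le> w"
    then have "r z \<le> r w" unfolding r_def by (meson inf_mono order_refl sup_mono)
    then show "f (r z) \<le> f (r w)" using f(2) rI by (meson mono_onD)
  qed
  moreover have "r y = y" "r x = b" using b by (auto simp: r_def inf_absorb1 inf_absorb2)
  ultimately show thesis using that[of "\<lambda>z. f (r z)"] f(3) by auto
qed

section \<open>Separating a point from the complement of a neighbourhood\<close>

text \<open>
  Composed with a separating function, the ramp gives a function that vanishes on a whole
  neighbourhood of the point to be avoided, as the compactness argument below requires.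
\<close>

lemma ramp:
  fixes a b :: real
  assumes "a < b"
  obtains \<phi> :: "real \<Rightarrow> real" and m where "continuous_on UNIV \<phi>" "mono \<phi>"
    "range \<phi> \<subseteq> {0..1}" "\<phi> b = 1" "a < m" "\<forall>t<m. \<phi> t = 0"
proof -
  define m where "m = (a + b) / 2"
  have m: "a < m" "m < b" using assms by (auto simp: m_def)
  define \<phi> where "\<phi> t = max 0 (min 1 ((t - m) / (b - m)))" for t
  show thesis
  proof (rule that[of \<phi> m])
    show "continuous_on UNIV \<phi>"
      unfolding \<phi>_def using m by (intro continuous_intros) auto
    show "mono \<phi>"
      unfolding \<phi>_def using m
      by (intro monoI max.mono min.mono order_refl divide_right_mono) auto
  qed (use m in \<open>auto simp: \<phi>_def min_def max_def zero_le_divide_iff\<close>)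
qed

definition bump_pair :: "'a::{topological_space, order} \<Rightarrow> ('a \<Rightarrow> real) \<Rightarrow> ('a \<Rightarrow> real) \<Rightarrow> bool" where
  "bump_pair x f g \<longleftrightarrow>
     continuous_on UNIV f \<and> range f \<subseteq> {0..1} \<and> mono f \<and>
     continuous_on UNIV g \<and> range g \<subseteq> {0..1} \<and> antimono g \<and> f x = 1 \<and> g x = 1"

lemma bump_pair_min:
  assumes "bump_pair x f g" "bump_pair x f' g'"
  shows "bump_pair x (\<lambda>z. min (f z) (f' z)) (\<lambda>z. min (g z) (g' z))"
  unfolding bump_pair_def
proof (intro conjI)
  show "mono (\<lambda>z. min (f z) (f' z))"
    using assms unfolding bump_pair_def by (intro monoI min.mono) (auto dest: monoD)
  show "antimono (\<lambda>z. min (g z) (g' z))"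
    using assms unfolding bump_pair_def by (intro antimonoI min.mono) (auto dest: antimonoD)
  show "continuous_on UNIV (\<lambda>z. min (f z) (f' z))" "continuous_on UNIV (\<lambda>z. min (g z) (g' z))"
    using assms unfolding bump_pair_def by (auto intro: continuous_on_min)
qed (use assms in \<open>simp_all add: bump_pair_def image_subset_iff min_le_iff_disj\<close>)

text \<open>
  Either \<open>c\<close> is not above \<open>x\<close>, and an increasing function vanishes near \<open>c\<close>, or \<open>c\<close> is not
  below \<open>x\<close>, and a decreasing one does. The constant 1 serves as the other member of the pair.
\<close>

lemma bump_pair_vanishing_near_point:
  fixes x c :: "'a::{t2_space, lattice}"
  assumes L: "topological_lattice TYPE('a)"
    and lc: "locally_compact_space (euclidean :: 'a topology)"
    and con: "connected (UNIV :: 'a set)"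
    and "c \<noteq> x"
  shows "\<exists>f g N. bump_pair x f g \<and> open N \<and> c \<in> N \<and> (\<forall>z\<in>N. min (f z) (g z) = 0)"
proof -
  have c1: "continuous_on UNIV (\<lambda>z::'a. 1::real)" "mono (\<lambda>z::'a. 1::real)"
       "antimono (\<lambda>z::'a. 1::real)"
    by (auto intro: monoI antimonoI)
  consider "\<not> x \<le> c" | "\<not> c \<le> x" using \<open>c \<noteq> x\<close> by fastforce
  then show ?thesis
  proof cases
    case 1
    obtain h :: "'a \<Rightarrow> real" where h: "continuous_on UNIV h" "mono h" "h c < h x"
      using monotone_separation[OF L lc con 1] .
    obtain \<phi> :: "real \<Rightarrow> real" and m where \<phi>: "continuous_on UNIV \<phi>" "mono \<phi>" "range \<phi> \<subseteq> {0..1}" "\<phi> (h x) = 1"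
      "h c < m" "\<forall>t<m. \<phi> t = 0"
      by (rule ramp[OF h(3)])
    have "continuous_on UNIV (\<lambda>z. \<phi> (h z))"
      by (rule continuous_on_compose2[OF \<phi>(1) h(1)]) simp
    moreover have "mono (\<lambda>z. \<phi> (h z))"
      by (intro monoI monoD[OF \<phi>(2)] monoD[OF h(2)])
    ultimately have "bump_pair x (\<lambda>z. \<phi> (h z)) (\<lambda>_. 1)"
      using c1 \<phi>(3,4) by (simp add: bump_pair_def image_subset_iff)
    moreover have "open {z. h z < m}" by (intro open_Collect_less h continuous_intros)
    ultimately show ?thesis using \<phi>(5,6)
      by (intro exI[of _ "\<lambda>z. \<phi> (h z)"] exI[of _ "\<lambda>_. 1"] exI[of _ "{z. h z < m}"]) simp
  next
    case 2
    obtain h :: "'a \<Rightarrow> real" where h: "continuous_on UNIV h" "mono h" "h x < h c"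
      using monotone_separation[OF L lc con 2] .
    have neg: "- h c < - h x" using h(3) by simp
    obtain \<phi> :: "real \<Rightarrow> real" and m where \<phi>: "continuous_on UNIV \<phi>" "mono \<phi>" "range \<phi> \<subseteq> {0..1}" "\<phi> (- h x) = 1"
      "- h c < m" "\<forall>t<m. \<phi> t = 0"
      by (rule ramp[OF neg])
    have "continuous_on UNIV (\<lambda>z. \<phi> (- h z))"
      by (rule continuous_on_compose2[OF \<phi>(1) continuous_on_minus[OF h(1)]]) simp
    moreover have "antimono (\<lambda>z. \<phi> (- h z))"
      by (intro antimonoI monoD[OF \<phi>(2)] le_imp_neg_le monoD[OF h(2)])
    ultimately have "bump_pair x (\<lambda>_. 1) (\<lambda>z. \<phi> (- h z))"
      using c1 \<phi>(3,4) by (simp add: bump_pair_def image_subset_iff)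
    moreover have "open {z. - h z < m}"
      by (intro open_Collect_less continuous_on_minus h continuous_intros)
    ultimately show ?thesis using \<phi>(5,6)
      by (intro exI[of _ "\<lambda>_. 1"] exI[of _ "\<lambda>z. \<phi> (- h z)"] exI[of _ "{z. - h z < m}"]) simp
  qed
qed

lemma bump_pair_vanishing_on_compact:
  fixes x :: "'a::{t2_space, lattice}"
  assumes L: "topological_lattice TYPE('a)"
    and lc: "locally_compact_space (euclidean :: 'a topology)"
    and con: "connected (UNIV :: 'a set)"
    and "compact B" "x \<notin> B"
  shows "\<exists>f g. bump_pair x f g \<and> (\<forall>z\<in>B. min (f z) (g z) = 0)"
proof -
  have "\<forall>c\<in>B. \<exists>f g N. bump_pair x f g \<and> open N \<and> c \<in> N \<and> (\<forall>z\<in>N. min (f z) (g z) = 0)"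
    using bump_pair_vanishing_near_point[OF L lc con] \<open>x \<notin> B\<close> by metis
  then obtain N where N: "\<And>c. c \<in> B \<Longrightarrow> \<exists>f g. bump_pair x f g \<and> (\<forall>z\<in>N c. min (f z) (g z) = 0)"
      "\<And>c. c \<in> B \<Longrightarrow> open (N c)" "\<And>c. c \<in> B \<Longrightarrow> c \<in> N c"
    by metis
  obtain D where D: "D \<subseteq> B" "finite D" "B \<subseteq> (\<Union>c\<in>D. N c)"
    by (rule compactE_image[OF \<open>compact B\<close>, of B N]) (use N in auto)
  from D(2,1) have "\<exists>f g. bump_pair x f g \<and> (\<forall>z\<in>(\<Union>c\<in>D. N c). min (f z) (g z) = 0)"
  proof (induction D rule: finite_induct)
    case empty
    have "bump_pair x (\<lambda>_. 1) (\<lambda>_. 1)"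
      by (auto simp: bump_pair_def intro: monoI antimonoI)
    then show ?case by auto
  next
    case (insert c D)
    obtain f g where fg: "bump_pair x f g" "\<forall>z\<in>(\<Union>c\<in>D. N c). min (f z) (g z) = 0"
      using insert by auto
    obtain f' g' where fg': "bump_pair x f' g'" "\<forall>z\<in>N c. min (f' z) (g' z) = 0"
      using N insert.prems by blast
    have nn: "0 \<le> f z" "0 \<le> g z" "0 \<le> f' z" "0 \<le> g' z" for z
      using fg(1) fg'(1) by (auto simp: bump_pair_def image_subset_iff)
    have "min (min (f z) (f' z)) (min (g z) (g' z)) = 0" if "z \<in> (\<Union>c\<in>insert c D. N c)" for z
    proof -
      have "min (f z) (g z) = 0 \<or> min (f' z) (g' z) = 0" using that fg(2) fg'(2) by blast
      then show ?thesis using nn[of z] by (auto simp: min_def split: if_splits)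
    qed
    then show ?case using bump_pair_min[OF fg(1) fg'(1)] by blast
  qed
  then show ?thesis using D(3) by blast
qed

text \<open>
  A pair whose minimum vanishes on the frontier of \<open>U\<close> may have positive minimum far away from \<open>x\<close>.
  Precomposing with \<open>inf z x\<close> and \<open>sup z x\<close> relates \<open>z\<close> to \<open>x\<close> by intervals on which that minimum
  stays positive, so that the frontier cannot be crossed between \<open>x\<close> and \<open>z\<close>.
\<close>

lemma bump_pair_vanishing_off_neighbourhood:
  fixes x :: "'a::{t2_space, lattice}"
  assumes L: "topological_lattice TYPE('a)"
    and lc: "locally_compact_space (euclidean :: 'a topology)"
    and con: "connected (UNIV :: 'a set)"
    and "open V" "x \<in> V"
  shows "\<exists>f g. bump_pair x f g \<and> (\<forall>z\<in>-V. min (f z) (g z) = 0)"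
proof -
  obtain U C where U: "open U" "x \<in> U" "U \<subseteq> V" "compact (frontier U)"
    using small_open_with_compact_frontier[OF lc \<open>open V\<close> \<open>x \<in> V\<close>] by metis
  have "x \<notin> frontier U" using U by (simp add: frontier_def interior_open)
  then obtain f g where fg: "bump_pair x f g" and B: "\<And>z. z \<in> frontier U \<Longrightarrow> min (f z) (g z) = 0"
    using bump_pair_vanishing_on_compact[OF L lc con U(4)] by blast
  have cf: "continuous_on UNIV f" and rf: "range f \<subseteq> {0..1}" and mf: "mono f"
    and cg: "continuous_on UNIV g" and rg: "range g \<subseteq> {0..1}" and mg: "antimono g"
    and x1: "f x = 1" "g x = 1"
    using fg by (auto simp: bump_pair_def)
  have nn: "0 \<le> f z" "0 \<le> g z" for z using rf rg by (auto simp: image_subset_iff)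
  \<comment> \<open>On \<open>{w..w'}\<close> the increasing \<open>f\<close> is at least \<open>f w\<close> and the decreasing \<open>g\<close> at least \<open>g w'\<close>, so
     \<open>min f g\<close> is positive there and the interval misses the frontier. The ends \<open>w \<le> w'\<close>
     are \<open>u\<close> and \<open>v\<close> in either order, as one crosses downwards from \<open>x\<close> and then upwards to \<open>z\<close>.\<close>
  have conv: "v \<in> U" if "u \<in> U" "w = u \<and> w' = v \<or> w = v \<and> w' = u" "w \<le> w'" "0 < f w" "0 < g w'"
    for u v w w'
  proof (rule ccontr)
    assume "v \<notin> U"
    then have "{w..w'} \<inter> frontier U \<noteq> {}"
      using that by (intro connected_Int_frontier connected_interval[OF L con]) auto
    then obtain c where c: "w \<le> c" "c \<le> w'" "c \<in> frontier U" by auto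
    then have "f w \<le> f c" "g w' \<le> g c" using mf mg by (auto simp: mono_def antimono_def)
    then show False using B[OF c(3)] that by (auto simp: min_def split: if_splits)
  qed
  define F where "F z = f (inf z x)" for z
  define G where "G z = g (sup z x)" for z
  have "bump_pair x F G"
    unfolding bump_pair_def
  proof (intro conjI)
    show "continuous_on UNIV F" unfolding F_def
      by (rule continuous_on_compose2[OF cf]) (auto intro!: continuous_on_inf_sup[OF L] continuous_intros)
    show "continuous_on UNIV G" unfolding G_def
      by (rule continuous_on_compose2[OF cg]) (auto intro!: continuous_on_inf_sup[OF L] continuous_intros)
    show "mono F" unfolding F_def
      by (intro monoI monoD[OF mf] inf_mono order_refl)
    show "antimono G" unfolding G_def
      by (intro antimonoI antimonoD[OF mg] sup_mono order_refl)
  qed (use rf rg x1 in \<open>auto simp: F_def G_def image_subset_iff\<close>)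
  moreover have "min (F z) (G z) = 0" if "z \<notin> V" for z
  proof (rule ccontr)
    assume "min (F z) (G z) \<noteq> 0"
    then have pos: "0 < f (inf z x)" "0 < g (sup z x)"
      using nn[of "inf z x"] nn[of "sup z x"] by (auto simp: F_def G_def min_def split: if_splits)
    have inU: "inf z x \<in> U"
      by (rule conv[of x "inf z x" x]) (use U pos x1 in auto)
    have "0 < g z"
      using pos(2) antimonoD[OF mg, of z "sup z x"] by auto
    then have "z \<in> U"
      by (rule conv[OF inU _ inf_le1 pos(1), rotated]) simp
    then show False using U that by auto
  qed
  ultimately show ?thesis by blast
qed

theorem theorem26:
  assumes "topological_lattice TYPE('a::{t2_space, lattice})"
    and "locally_compact_space (euclidean :: 'a topology)"
    and "connected (UNIV :: 'a set)"
  shows "completely_regular_ordered_space TYPE('a)"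
  unfolding completely_regular_ordered_space_def
proof (intro conjI allI impI)
  show "topological_poset TYPE('a)" by (rule topological_lattice_imp_poset[OF assms(1)])
  show "\<exists>f :: 'a \<Rightarrow> real. continuous_on UNIV f \<and> mono f \<and> f x > f y" if "\<not> x \<le> y" for x y :: 'a
    using monotone_separation[OF assms that] by metis
  fix x :: 'a and V
  assume "x \<in> interior V"
  then obtain f g :: "'a \<Rightarrow> real" where "bump_pair x f g" 
    and "\<forall>z \<in> - interior V. min (f z) (g z) = 0"
    using bump_pair_vanishing_off_neighbourhood[OF assms open_interior] by blast
  then show "\<exists>f g :: 'a \<Rightarrow> real.
           continuous_on UNIV f \<and> range f \<subseteq> {0..1} \<and> mono f \<and>
           continuous_on UNIV g \<and> range g \<subseteq> {0..1} \<and> antimono g \<and>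
           f x = 1 \<and> g x = 1 \<and> (\<forall>z \<in> - V. min (f z) (g z) = 0)"
    using interior_subset[of V] unfolding bump_pair_def by blast
qed

end
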